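(* Let $p,q$ be positive integers. The complete bipartite graph $K_{p,q}$ is P2-win if at least one of $p,q$ is even. If $p = 3$ and $q \ge 5$ is odd, then $K_{p,q}$ is P1-win.
   Context: Trail Trap on a finite simple undirected graph $G$: Player 1 (P1) chooses a vertex, places a token on it and moves it along an incident edge $e$ to the other endpoint. Player 2 (P2) then places their own token on any vertex and moves it along an incident edge $f \neq e$. Thereafter the players alternate, starting with P1, each moving their own token from its current vertex along an unused edge (an edge not previously traversed, in either direction, by either player) to the adjacent vertex; vertices may be revisited and the two tokens may share a vertex. The first player unable to move loses. $G$ is P1-win if P1 has a winning strategy, and P2-win otherwise. *)

theory Defs
  imports "Graph_Theory.Kuratowski"
begin

text \<open>
  Trail Trap. An undirected graph is a symmetric digraph (locale \<^locale>\<open>graph\<close>), so the arcs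
  \<open>(u, v)\<close> and \<open>(v, u)\<close> are the two directions of traversing one undirected edge \<open>{u, v}\<close>.
  A history is the list of all traversals \<open>(u, v)\<close> made so far, oldest first; Player 1 makes
  those at the even positions (counting from 0) and Player 2 those at the odd positions.
  A player's first move combines placing the token on \<open>u\<close> with moving it to \<open>v\<close>.
\<close>

type_synonym 'a history = "('a \<times> 'a) list"

definition used_edges :: "'a history \<Rightarrow> 'a set set" where
  "used_edges h = (\<lambda>(u, v). {u, v}) ` set h"

text \<open>
  From the third move on, the token of the player to move is where that player's previous move,
  two positions back in the history, left it.
\<close>

definition legal_move :: "('a, 'b) pre_digraph \<Rightarrow> 'a history \<Rightarrow> 'a \<times> 'a \<Rightarrow> bool" where
  "legal_move G h m \<longleftrightarrow>
     m \<in> arcs_ends G \<and>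
     {fst m, snd m} \<notin> used_edges h \<and>
     (2 \<le> length h \<longrightarrow> fst m = snd (h ! (length h - 2)))"

definition legal_history :: "('a, 'b) pre_digraph \<Rightarrow> 'a history \<Rightarrow> bool" where
  "legal_history G h \<longleftrightarrow> (\<forall>i < length h. legal_move G (take i h) (h ! i))"

definition stuck :: "('a, 'b) pre_digraph \<Rightarrow> 'a history \<Rightarrow> bool" where
  "stuck G h \<longleftrightarrow> (\<nexists>m. legal_move G h m)"

definition P1_strategy :: "('a, 'b) pre_digraph \<Rightarrow> ('a history \<Rightarrow> 'a \<times> 'a) \<Rightarrow> bool" where
  "P1_strategy G \<sigma> \<longleftrightarrow>
     (\<forall>h. legal_history G h \<and> even (length h) \<and> \<not> stuck G h \<longrightarrow> legal_move G h (\<sigma> h))"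

definition follows_P1 :: "('a history \<Rightarrow> 'a \<times> 'a) \<Rightarrow> 'a history \<Rightarrow> bool" where
  "follows_P1 \<sigma> h \<longleftrightarrow> (\<forall>i < length h. even i \<longrightarrow> h ! i = \<sigma> (take i h))"

text \<open>
  On a finite graph every legal history extends to one in which the player to move is stuck.
  That player loses; it is Player 2 iff the length is odd.
\<close>

definition P1_winning_strategy :: "('a, 'b) pre_digraph \<Rightarrow> ('a history \<Rightarrow> 'a \<times> 'a) \<Rightarrow> bool" where
  "P1_winning_strategy G \<sigma> \<longleftrightarrow>
     P1_strategy G \<sigma> \<and>
     (\<forall>h. legal_history G h \<and> follows_P1 \<sigma> h \<and> stuck G h \<longrightarrow> odd (length h))"

definition P1_win :: "('a, 'b) pre_digraph \<Rightarrow> bool" where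
  "P1_win G \<longleftrightarrow> (\<exists>\<sigma>. P1_winning_strategy G \<sigma>)"

definition P2_win :: "('a, 'b) pre_digraph \<Rightarrow> bool" where
  "P2_win G \<longleftrightarrow> \<not> P1_win G"

end

theory Submission
  imports Defs
begin

text \<open>
  If one side is even, a fixed-point-free involution of that side, extended by the identity, is
  an automorphism moving every edge, and Player 2 answers each move by its mirror image.

  If one side \<open>A\<close> has three vertices, the other side \<open>B\<close> is used up visit by visit: passing
  through a vertex of \<open>B\<close> leaves a single edge there, and whoever enters it later is stuck.
  Player 1 opens by moving from \<open>A\<close> to \<open>B\<close>. The number of remaining passages then has the parity
  that lets Player 1 make the last one, and Player 2 has to enter a dead end. It remains to see that
  Player 1 still has a move afterwards: the exits can be chosen such that Player 1's final position
  keeps a dead-end edge.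
\<close>

section \<open>Mirroring\<close>

text \<open>Induction on half the cardinality: two elements are swapped and the rest is paired off
  by the induction hypothesis.\<close>

lemma even_card_involution:
  assumes "finite U" "even (card U)"
  obtains \<phi> where "\<And>u. u \<in> U \<Longrightarrow> \<phi> u \<in> U" "\<And>u. u \<in> U \<Longrightarrow> \<phi> u \<noteq> u"
    "\<And>u. \<phi> (\<phi> u) = u" "\<And>u. u \<notin> U \<Longrightarrow> \<phi> u = u"
proof -
  obtain k where "card U = 2 * k"
    using assms(2) by blast
  with assms(1) have "\<exists>\<phi>. (\<forall>u\<in>U. \<phi> u \<in> U \<and> \<phi> u \<noteq> u) \<and> (\<forall>u. \<phi> (\<phi> u) = u) \<and> (\<forall>u. u \<notin> U \<longrightarrow> \<phi> u = u)"
  proof (induction k arbitrary: U)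
    case 0
    then have "U = {}" by simp
    then show ?case by (intro exI[of _ id]) simp
  next
    case (Suc k)
    then have "\<not> card U \<le> Suc 0" by simp
    then obtain u v where uv: "u \<in> U" "v \<in> U" "u \<noteq> v"
      using card_le_Suc0_iff_eq[OF Suc.prems(1)] by blast
    have "card (U - {u, v}) = 2 * k" using uv Suc.prems by (simp add: card_Diff_subset)
    then obtain \<phi> where \<phi>: "\<forall>w\<in>U - {u, v}. \<phi> w \<in> U - {u, v} \<and> \<phi> w \<noteq> w" "\<forall>w. \<phi> (\<phi> w) = w"
      "\<forall>w. w \<notin> U - {u, v} \<longrightarrow> \<phi> w = w"
      using Suc.IH[of "U - {u, v}"] Suc.prems by auto
    define \<psi> where "\<psi> = \<phi>(u := v, v := u)"
    have \<psi>: "\<psi> u = v" "\<psi> v = u" and \<psi>_other: "\<And>w. w \<noteq> u \<Longrightarrow> w \<noteq> v \<Longrightarrow> \<psi> w = \<phi> w"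
      by (auto simp: \<psi>_def uv(3))
    \<comment> \<open>Away from \<open>u\<close> and \<open>v\<close>, applying
      \<open>\<psi>\<close> twice therefore amounts to applying \<open>\<phi>\<close> twice.\<close>
    have ne: "\<phi> w \<noteq> u \<and> \<phi> w \<noteq> v" if "w \<noteq> u" "w \<noteq> v" for w
    proof (cases "w \<in> U")
      case True
      then show ?thesis using \<phi>(1) that by fast
    qed (use \<phi>(3) that in simp)
    have "\<psi> w \<in> U \<and> \<psi> w \<noteq> w" if "w \<in> U" for w
      using \<psi> \<psi>_other[of w] \<phi>(1) uv that by (cases "w = u"; cases "w = v") auto
    moreover have "\<psi> (\<psi> w) = w" for w
      using \<psi> \<psi>_other[of w] \<psi>_other[of "\<phi> w"] ne[of w] \<phi>(2) by (cases "w = u"; cases "w = v") auto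
    moreover have "\<psi> w = w" if "w \<notin> U" for w
      using \<psi>_other[of w] \<phi>(3) uv that by (cases "w = u"; cases "w = v") auto
    ultimately show ?case by blast
  qed
  then show thesis using that by blast
qed

section \<open>Legal histories and the mirror strategy\<close>

lemma used_edges_Nil [simp]: "used_edges [] = {}"
  by (simp add: used_edges_def)

lemma used_edges_append [simp]: "used_edges (h @ [m]) = insert {fst m, snd m} (used_edges h)"
  by (auto simp: used_edges_def case_prod_beta)

lemma legal_history_Nil [simp]: "legal_history G []"
  by (simp add: legal_history_def)

lemma legal_history_append [simp]:
  "legal_history G (h @ [m]) \<longleftrightarrow> legal_history G h \<and> legal_move G h m"
  by (auto simp: legal_history_def nth_append less_Suc_eq)

lemma follows_P1_append [simp]:
  "follows_P1 \<sigma> (h @ [m]) \<longleftrightarrow> follows_P1 \<sigma> h \<and> (even (length h) \<longrightarrow> m = \<sigma> h)"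
  by (auto simp: follows_P1_def nth_append less_Suc_eq)

lemma legal_history_distinct:
  "legal_history G h \<Longrightarrow> distinct h \<and> set h \<subseteq> arcs_ends G"
proof (induction h rule: rev_induct)
  case (snoc m h)
  then have "m \<in> arcs_ends G" "{fst m, snd m} \<notin> used_edges h"
    by (auto simp: legal_move_def)
  then have "m \<notin> set h"
    by (force simp: used_edges_def)
  with snoc \<open>m \<in> arcs_ends G\<close> show ?case by simp
qed simp

lemma legal_history_length:
  "finite (arcs_ends G) \<Longrightarrow> legal_history G h \<Longrightarrow> length h \<le> card (arcs_ends G)"
  by (metis legal_history_distinct card_mono distinct_card)

text \<open>If Player 1 had a winning strategy, mirroring against it would never break off and would
  yield legal histories of every even length, against the length bound of a finite graph.\<close>

lemma mirror_P2_win: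
  assumes fin: "finite (arcs_ends G)"
    and inv: "\<And>u. \<phi> (\<phi> u) = u"
    and arc: "\<And>u v. (u, v) \<in> arcs_ends G \<Longrightarrow> (\<phi> u, \<phi> v) \<in> arcs_ends G"
    and ne: "\<And>u v. (u, v) \<in> arcs_ends G \<Longrightarrow> {\<phi> u, \<phi> v} \<noteq> {u, v}"
  shows "P2_win G"
  unfolding P2_win_def P1_win_def
proof
  assume "\<exists>\<sigma>. P1_winning_strategy G \<sigma>"
  then obtain \<sigma> where \<sigma>: "P1_strategy G \<sigma>"
    "\<And>h. legal_history G h \<Longrightarrow> follows_P1 \<sigma> h \<Longrightarrow> stuck G h \<Longrightarrow> odd (length h)"
    by (auto simp: P1_winning_strategy_def)
  have "\<exists>h. length h = 2 * k \<and> legal_history G h \<and> follows_P1 \<sigma> h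
      \<and> (\<forall>e. e \<in> used_edges h \<longleftrightarrow> \<phi> ` e \<in> used_edges h)
      \<and> (0 < k \<longrightarrow> snd (h ! (2 * k - 1)) = \<phi> (snd (h ! (2 * k - 2))))" for k
  proof (induction k)
    case 0
    show ?case by (intro exI[of _ "[]"]) (simp add: follows_P1_def)
  next
    case (Suc k)
    then obtain h where h: "length h = 2 * k" "legal_history G h" "follows_P1 \<sigma> h"
      "\<And>e. e \<in> used_edges h \<longleftrightarrow> \<phi> ` e \<in> used_edges h"
      "0 < k \<Longrightarrow> snd (h ! (2 * k - 1)) = \<phi> (snd (h ! (2 * k - 2)))"
      by blast
    then have "\<not> stuck G h" using \<sigma>(2)[of h] by auto
    then have leg: "legal_move G h (\<sigma> h)" using \<sigma>(1) h by (auto simp: P1_strategy_def)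
    obtain u v where m: "\<sigma> h = (u, v)" by force
    let ?h = "h @ [(u, v)]"
    have uv: "(u, v) \<in> arcs_ends G" "{u, v} \<notin> used_edges h"
      "0 < k \<Longrightarrow> u = snd (h ! (2 * k - 2))"
      using leg m h(1) by (auto simp: legal_move_def)
    have "{\<phi> u, \<phi> v} \<notin> used_edges h"
      using h(4)[of "{u, v}"] uv(2) by simp
    \<comment> \<open>Invariance of the used edges covers the earlier moves; \<open>ne\<close>
      excludes the edge that Player 1 has just taken.\<close>
    then have leg2: "legal_move G ?h (\<phi> u, \<phi> v)"
      using arc[OF uv(1)] ne[OF uv(1)] h(5) uv(3) h(1)
      by (auto simp: legal_move_def nth_append)
    have eqv: "\<phi> ` e = {\<phi> u, \<phi> v} \<longleftrightarrow> e = {u, v}" "\<phi> ` e = {u, v} \<longleftrightarrow> e = {\<phi> u, \<phi> v}" for e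
    proof -
      have "inj \<phi>" using inv by (rule inj_on_inverseI)
      then have "\<phi> ` e = \<phi> ` {u, v} \<longleftrightarrow> e = {u, v}" "\<phi> ` e = \<phi> ` {\<phi> u, \<phi> v} \<longleftrightarrow> e = {\<phi> u, \<phi> v}"
        by (rule inj_image_eq_iff)+
      then show "\<phi> ` e = {\<phi> u, \<phi> v} \<longleftrightarrow> e = {u, v}" "\<phi> ` e = {u, v} \<longleftrightarrow> e = {\<phi> u, \<phi> v}"
        using inv by simp_all
    qed
    let ?h' = "?h @ [(\<phi> u, \<phi> v)]"
    have "length ?h' = 2 * Suc k \<and> legal_history G ?h' \<and> follows_P1 \<sigma> ?h'"
      unfolding legal_history_append follows_P1_append using h(1-3) leg leg2 m by simp
    moreover have "e \<in> used_edges ?h' \<longleftrightarrow> \<phi> ` e \<in> used_edges ?h'" for e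
      unfolding used_edges_append fst_conv snd_conv insert_iff eqv using h(4)[of e] by blast
    moreover have "snd (?h' ! (2 * Suc k - 1)) = \<phi> (snd (?h' ! (2 * Suc k - 2)))"
      using h(1) by (simp add: nth_append)
    ultimately show ?case by blast
  qed
  from this[of "card (arcs_ends G) + 1"] show False
    using legal_history_length[OF fin] by fastforce
qed

section \<open>Winning positions\<close>

text \<open>A stuck Player 2 satisfies \<open>P2_turn\<close> vacuously, whereas no rule applies to
  a stuck Player 1.\<close>

inductive P1_forces :: "('a, 'b) pre_digraph \<Rightarrow> 'a history \<Rightarrow> bool" for G where
  P1_turn: "even (length h) \<Longrightarrow> legal_move G h m \<Longrightarrow> P1_forces G (h @ [m]) \<Longrightarrow> P1_forces G h"
| P2_turn: "odd (length h) \<Longrightarrow> (\<And>m. legal_move G h m \<Longrightarrow> P1_forces G (h @ [m])) \<Longrightarrow> P1_forces G h"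

lemma P1_forces_even:
  "P1_forces G h \<Longrightarrow> even (length h) \<Longrightarrow> \<exists>m. legal_move G h m \<and> P1_forces G (h @ [m])"
  by (cases rule: P1_forces.cases) auto

lemma P1_forces_odd:
  "P1_forces G h \<Longrightarrow> odd (length h) \<Longrightarrow> legal_move G h m \<Longrightarrow> P1_forces G (h @ [m])"
  by (erule P1_forces.cases) simp_all

text \<open>Choosing moves that keep \<open>P1_forces\<close> preserves it along the play, and there
  Player 1 always has a legal move.\<close>

lemma P1_forces_P1_win:
  assumes "P1_forces G []"
  shows "P1_win G"
proof -
  \<comment> \<open>The second branch is there for \<open>P1_strategy\<close>, which demands a legal
    move at every non-stuck history on Player 1's turn.\<close>
  define \<sigma> where "\<sigma> h = (if P1_forces G h then SOME m. legal_move G h m \<and> P1_forces G (h @ [m])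
    else SOME m. legal_move G h m)" for h
  have \<sigma>: "legal_move G h (\<sigma> h) \<and> P1_forces G (h @ [\<sigma> h])" if "P1_forces G h" "even (length h)" for h
    using someI_ex[OF P1_forces_even[OF that]] that by (simp add: \<sigma>_def)
  have "P1_strategy G \<sigma>"
    unfolding P1_strategy_def
  proof (intro allI impI, elim conjE)
    fix h assume "even (length h)" "\<not> stuck G h"
    then show "legal_move G h (\<sigma> h)"
      using \<sigma>[of h] by (cases "P1_forces G h") (auto simp: \<sigma>_def stuck_def intro: someI)
  qed
  moreover have "P1_forces G h" if "legal_history G h" "follows_P1 \<sigma> h" for h
    using that
  proof (induction h rule: rev_induct)
    case (snoc m h)
    then show ?case using \<sigma>[of h] P1_forces_odd[of G h m] by (cases "even (length h)") auto
  qed (simp add: assms)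
  ultimately have "P1_winning_strategy G \<sigma>"
    unfolding P1_winning_strategy_def stuck_def using P1_forces_even by blast
  then show ?thesis unfolding P1_win_def by blast
qed

text \<open>
  Positions of the game on a bipartite graph with one side \<open>B\<close>: \<open>r b\<close> is the set of the
  neighbours of \<open>b \<in> B\<close> along unused edges, \<open>x\<close> and \<open>y\<close> are the tokens of Player 1 and Player 2;
  it is Player 1's turn in \<open>win1\<close> and Player 2's turn in \<open>win2\<close>.
\<close>

inductive win1 :: "'a set \<Rightarrow> ('a \<Rightarrow> 'a set) \<Rightarrow> 'a \<Rightarrow> 'a \<Rightarrow> bool"
  and win2 :: "'a set \<Rightarrow> ('a \<Rightarrow> 'a set) \<Rightarrow> 'a \<Rightarrow> 'a \<Rightarrow> bool" for B where
  enter1: "b \<in> B \<Longrightarrow> x \<in> r b \<Longrightarrow> win2 B (r(b := r b - {x})) b y \<Longrightarrow> win1 B r x y"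
| exit1: "x \<in> B \<Longrightarrow> a \<in> r x \<Longrightarrow> win2 B (r(x := r x - {a})) a y \<Longrightarrow> win1 B r x y"
| enter2: "y \<notin> B \<Longrightarrow> (\<And>b. b \<in> B \<Longrightarrow> y \<in> r b \<Longrightarrow> win1 B (r(b := r b - {y})) x b) \<Longrightarrow> win2 B r x y"
| exit2: "y \<in> B \<Longrightarrow> (\<And>a. a \<in> r y \<Longrightarrow> win1 B (r(y := r y - {a})) x a) \<Longrightarrow> win2 B r x y"

definition unused :: "'a set \<Rightarrow> 'a history \<Rightarrow> 'a \<Rightarrow> 'a set" where
  "unused A h b = {a \<in> A. {a, b} \<notin> used_edges h}"

lemma win_P1_forces:
  assumes arcs: "arcs_ends G = A \<times> B \<union> B \<times> A" and disj: "A \<inter> B = {}"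
  shows "win1 B r x y \<Longrightarrow> \<forall>h. even (length h) \<longrightarrow> 2 \<le> length h \<longrightarrow> (\<forall>b\<in>B. r b = unused A h b) \<longrightarrow>
      x = snd (h ! (length h - 2)) \<longrightarrow> y = snd (h ! (length h - 1)) \<longrightarrow> P1_forces G h"
    and "win2 B r x y \<Longrightarrow> \<forall>h. odd (length h) \<longrightarrow> 2 \<le> length h \<longrightarrow> (\<forall>b\<in>B. r b = unused A h b) \<longrightarrow>
      x = snd (h ! (length h - 1)) \<longrightarrow> y = snd (h ! (length h - 2)) \<longrightarrow> P1_forces G h"
proof (induction rule: win1_win2.inducts)
  case (enter1 b x r y)
  show ?case
  proof (intro allI impI)
    fix h assume h: "even (length h)" "2 \<le> length h" "\<forall>b\<in>B. r b = unused A h b"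
      "x = snd (h ! (length h - 2))" "y = snd (h ! (length h - 1))"
    then have x: "x \<in> A" "{x, b} \<notin> used_edges h" using enter1 by (auto simp: unused_def)
    then have "legal_move G h (x, b)" using h enter1 arcs by (auto simp: legal_move_def)
    moreover have "\<forall>c\<in>B. (r(b := r b - {x})) c = unused A (h @ [(x, b)]) c"
      using h(3) x disj enter1 by (auto simp: unused_def doubleton_eq_iff)
    ultimately show "P1_forces G h"
      using h(1,2,5) enter1.IH(3)[rule_format, of "h @ [(x, b)]"]
      by (intro P1_turn[of h G "(x, b)"]) (auto simp: nth_append)
  qed
next
  case (exit1 x a r y)
  show ?case
  proof (intro allI impI)
    fix h assume h: "even (length h)" "2 \<le> length h" "\<forall>b\<in>B. r b = unused A h b"
      "x = snd (h ! (length h - 2))" "y = snd (h ! (length h - 1))"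
    then have a: "a \<in> A" "{x, a} \<notin> used_edges h" using exit1 by (auto simp: unused_def insert_commute)
    then have "legal_move G h (x, a)" using h exit1 arcs by (auto simp: legal_move_def)
    moreover have "\<forall>c\<in>B. (r(x := r x - {a})) c = unused A (h @ [(x, a)]) c"
      using h(3) a disj exit1(1) by (auto simp: unused_def doubleton_eq_iff)
    ultimately show "P1_forces G h"
      using h(1,2,5) exit1.IH(3)[rule_format, of "h @ [(x, a)]"]
      by (intro P1_turn[of h G "(x, a)"]) (auto simp: nth_append)
  qed
next
  case (enter2 y r x)
  show ?case
  proof (intro allI impI)
    fix h assume h: "odd (length h)" "2 \<le> length h" "\<forall>b\<in>B. r b = unused A h b"
      "x = snd (h ! (length h - 1))" "y = snd (h ! (length h - 2))"
    show "P1_forces G h"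
    proof (rule P2_turn[OF h(1)])
      fix m assume "legal_move G h m"
      then obtain b where m: "m = (y, b)" "y \<in> A" "b \<in> B" "{y, b} \<notin> used_edges h"
        using h(2,5) arcs enter2(1) by (cases m) (auto simp: legal_move_def)
      then have "y \<in> r b" using h(3) by (auto simp: unused_def)
      moreover have "\<forall>c\<in>B. (r(b := r b - {y})) c = unused A (h @ [m]) c"
        using h(3) m disj by (auto simp: unused_def doubleton_eq_iff)
      ultimately show "P1_forces G (h @ [m])"
        using h(1,2,4) m(1) odd_pos[OF h(1)] by (intro enter2.IH(3)[OF m(3) \<open>y \<in> r b\<close>, rule_format, of "h @ [m]"])
          (simp_all add: nth_append del: fun_upd_apply)
    qed
  qed
next
  case (exit2 y r x)
  show ?case
  proof (intro allI impI)
    fix h assume h: "odd (length h)" "2 \<le> length h" "\<forall>b\<in>B. r b = unused A h b"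
      "x = snd (h ! (length h - 1))" "y = snd (h ! (length h - 2))"
    show "P1_forces G h"
    proof (rule P2_turn[OF h(1)])
      fix m assume leg: "legal_move G h m"
      have y: "fst m = y" using leg h(2,5) by (simp add: legal_move_def)
      have mem: "m \<in> A \<times> B \<union> B \<times> A" using leg by (simp add: legal_move_def arcs)
      have un: "{fst m, snd m} \<notin> used_edges h" using leg by (simp add: legal_move_def)
      obtain a where m: "m = (y, a)" using y by (metis prod.collapse)
      have a: "a \<in> A" "{a, y} \<notin> used_edges h"
        using mem un disj \<open>y \<in> B\<close> unfolding m by (auto simp: insert_commute)
      then have "a \<in> r y" using h(3) \<open>y \<in> B\<close> by (simp add: unused_def)
      moreover have "\<forall>c\<in>B. (r(y := r y - {a})) c = unused A (h @ [m]) c"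
        using h(3) m a disj \<open>y \<in> B\<close> by (auto simp: unused_def doubleton_eq_iff)
      ultimately show "P1_forces G (h @ [m])"
        using h(1,2,4) m(1) odd_pos[OF h(1)] by (intro exit2.IH(3)[OF \<open>a \<in> r y\<close>, rule_format, of "h @ [m]"])
          (simp_all add: nth_append del: fun_upd_apply)
    qed
  qed
qed


section \<open>Single moves and rounds between positions\<close>

lemma win1_opponent_stuck:
  assumes "x \<in> r b" "b \<in> B" "c \<in> B" "r c = {}"
  shows "win1 B r x c"
proof (rule enter1[where b = b])
  show "win2 B (r(b := r b - {x})) b c"
    by (rule exit2[OF assms(3)]) (use assms(4) in \<open>simp split: if_splits\<close>)
qed (use assms in simp_all)

lemma win1_dead_end:
  assumes "c \<in> B" "r c = {y}" "b \<in> B" "b \<noteq> c" "x \<in> r b"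
  shows "win1 B (r(c := r c - {y})) x c"
  by (rule win1_opponent_stuck[of x "r(c := r c - {y})" b]) (use assms in simp_all)

text \<open>Packages one passage of each player: Player 2 has just entered \<open>c\<close> from
  \<open>y\<close>, Player 1 enters \<open>b\<close>, and Player 1's exit \<open>x'\<close> may be
  chosen after seeing Player 2's exit \<open>y'\<close>.\<close>

lemma win1_round:
  assumes "c \<in> B" "b \<in> B" "c \<noteq> b" "x \<in> r b"
    and "\<And>y'. y' \<in> r c - {y} \<Longrightarrow>
      \<exists>x' \<in> r b - {x}. win2 B (r(c := r c - {y, y'}, b := r b - {x, x'})) x' y'"
  shows "win1 B (r(c := r c - {y})) x c"
proof (rule enter1[of b])
  let ?r = "r(c := r c - {y}, b := r b - {x})"
  have "win2 B ?r b c"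
  proof (rule exit2)
    fix y' assume "y' \<in> ?r c"
    then have "y' \<in> r c - {y}" using assms(3) by simp
    then obtain x' where x': "x' \<in> r b - {x}" "win2 B (r(c := r c - {y, y'}, b := r b - {x, x'})) x' y'"
      using assms(5) by blast
    have eq: "r(c := r c - {y, y'}, b := r b - {x, x'}) =
        (?r(c := ?r c - {y'}))(b := (?r(c := ?r c - {y'})) b - {x'})"
      using assms(3) by (auto simp: fun_eq_iff)
    show "win1 B (?r(c := ?r c - {y'})) b y'"
      by (rule exit1[of _ _ x']) (use assms(2,3) x' eq in auto)
  qed fact
  then show "win2 B ((r(c := r c - {y}))(b := (r(c := r c - {y})) b - {x})) b c"
    using assms(3) by simp
qed (use assms(2-4) in simp_all)

section \<open>Positions when one side has three vertices\<close>

locale K3n =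
  fixes A B :: "'a set"
  assumes card_A: "card A = 3" and fin_B: "finite B" and disj: "A \<inter> B = {}"
begin

lemma third:
  assumes "x \<in> A" "y \<in> A" "x \<noteq> y"
  obtains z where "A = {x, y, z}" "z \<noteq> x" "z \<noteq> y"
proof -
  have "finite A" using card_A card.infinite by force
  then have "card (A - {x, y}) = 1" using assms card_A by (simp add: card_Diff_subset)
  then obtain z where z: "A - {x, y} = {z}" by (auto simp: card_1_singleton_iff)
  then have "A = {x, y, z}" using assms by blast
  then show thesis using that z by blast
qed

lemma other:
  assumes "x \<in> A" "y \<in> A"
  obtains z where "z \<in> A" "z \<noteq> x" "z \<noteq> y"
proof -
  have "\<not> A \<subseteq> {x, y}"
    using card_A card_mono[of "{x, y}" A] card_insert_le_m1[of 2 "{y}" x] by fastforce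
  then show thesis using that by blast
qed

lemma A_notin_B: "x \<in> A \<Longrightarrow> x \<notin> B"
  using disj by blast

lemma A_not_subset_singleton: "\<not> A \<subseteq> {i}"
  using card_A card_mono[of "{i}" A] by auto

lemma A_ne_singleton [simp]: "A \<noteq> {i}" "{i} \<noteq> A"
  using A_not_subset_singleton by blast+

definition fresh :: "('a \<Rightarrow> 'a set) \<Rightarrow> 'a set" where
  "fresh r = {b \<in> B. r b = A}"

text \<open>A vertex of \<open>B\<close> that is not fresh has at most one edge left, so whoever
  enters it is trapped.\<close>

definition thin :: "('a \<Rightarrow> 'a set) \<Rightarrow> bool" where
  "thin r \<longleftrightarrow> (\<forall>b\<in>B. r b = A \<or> (\<exists>i. r b \<subseteq> {i}))"

text \<open>Insurance for Player 1's exit from a vertex entered from \<open>x\<close>, which must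
  lead into \<open>A - {x}\<close>: of two dead ends, Player 2 can enter only one.\<close>

definition reserve :: "('a \<Rightarrow> 'a set) \<Rightarrow> 'a \<Rightarrow> bool" where
  "reserve r x \<longleftrightarrow> (\<exists>b\<in>B. \<exists>c\<in>B. b \<noteq> c \<and> (\<exists>i\<in>A - {x}. r b = {i}) \<and> (\<exists>i\<in>A - {x}. r c = {i}))"

lemma reserveI:
  assumes "b \<in> B" "c \<in> B" "b \<noteq> c" "r b = {i}" "r c = {j}" "i \<in> A - {x}" "j \<in> A - {x}"
  shows "reserve r x"
  using assms unfolding reserve_def by blast

lemma finite_fresh [simp]: "finite (fresh r)"
  using fin_B by (simp add: fresh_def)

lemma fresh_upd:
  "S \<noteq> A \<Longrightarrow> T \<noteq> A \<Longrightarrow> fresh (r(b := S, c := T)) = fresh r - {b, c}"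
  by (auto simp: fresh_def)

lemma thin_upd:
  "thin r \<Longrightarrow> S \<subseteq> {i} \<Longrightarrow> T \<subseteq> {j} \<Longrightarrow> thin (r(b := S, c := T))"
  unfolding thin_def by auto

lemma leftover:
  assumes "x \<in> A" "y \<in> A - {x}"
  obtains i where "A - {x, y} = {i}" "i \<in> A" "i \<noteq> x" "i \<noteq> y"
proof -
  obtain z where z: "A = {x, y, z}" "z \<noteq> x" "z \<noteq> y"
    using third[of x y] assms by auto
  then have "A - {x, y} = {z}" by auto
  then show thesis using that[of z] z by auto
qed

lemma win2_final:
  assumes "y \<in> A" "thin r" "fresh r = {}"
    and "\<And>c. c \<in> B \<Longrightarrow> r c = {y} \<Longrightarrow> \<exists>b\<in>B. b \<noteq> c \<and> x \<in> r b"
  shows "win2 B r x y"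
proof (rule enter2)
  fix c assume c: "c \<in> B" "y \<in> r c"
  then have "r c = {y}" using assms(2,3) by (auto simp: thin_def fresh_def)
  with c assms(4) show "win1 B (r(c := r c - {y})) x c"
    using win1_dead_end by metis
qed (use assms(1) A_notin_B in blast)

text \<open>Here \<open>w\<close> is the vertex Player 2 has left to. If a reserve edge ends away
  from \<open>w\<close>, Player 1 leaves to its end; if both end at \<open>w\<close>, so does Player
  1, keeping the one Player 2 does not take. The position \<open>r'\<close> is quantified after
  \<open>x'\<close> because the position reached depends on that exit.\<close>

lemma reserve_exit:
  assumes "reserve r x"
  shows "\<exists>x'\<in>A - {x}. \<forall>r'. (\<forall>b. r b \<noteq> A \<longrightarrow> r' b = r b) \<longrightarrow>
    (\<forall>e. r' e = {w} \<longrightarrow> (\<exists>b\<in>B. b \<noteq> e \<and> x' \<in> r' b))"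
proof -
  obtain b c i j where bc: "b \<in> B" "c \<in> B" "b \<noteq> c" "i \<in> A - {x}" "r b = {i}" "j \<in> A - {x}" "r c = {j}"
    using assms by (auto simp: reserve_def)
  have eq: "r' b = {i} \<and> r' c = {j}" if "\<forall>b. r b \<noteq> A \<longrightarrow> r' b = r b" for r'
    using that bc by auto
  consider "i \<noteq> w" | "j \<noteq> w" | "i = w" "j = w" by blast
  then show ?thesis
  proof cases
    case 1
    have "\<exists>b\<in>B. b \<noteq> e \<and> i \<in> r' b" if "\<forall>b. r b \<noteq> A \<longrightarrow> r' b = r b" "r' e = {w}" for r' e
      using eq[OF that(1)] that(2) bc 1 by (intro bexI[of _ b]) auto
    with bc(4) show ?thesis by blast
  next
    case 2
    have "\<exists>b\<in>B. b \<noteq> e \<and> j \<in> r' b" if "\<forall>b. r b \<noteq> A \<longrightarrow> r' b = r b" "r' e = {w}" for r' e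
      using eq[OF that(1)] that(2) bc 2 by (intro bexI[of _ c]) auto
    with bc(6) show ?thesis by blast
  next
    case 3
    have "\<exists>b\<in>B. b \<noteq> e \<and> i \<in> r' b" if "\<forall>b. r b \<noteq> A \<longrightarrow> r' b = r b" for r' e
    proof (cases "e = b")
      case True
      then show ?thesis using eq[OF that] bc 3 by (intro bexI[of _ c]) auto
    next
      case False
      then show ?thesis using eq[OF that] bc by (intro bexI[of _ b]) auto
    qed
    with bc(4) show ?thesis by blast
  qed
qed

text \<open>
  Leaving to a vertex other than the one Player 2's last visit left an edge to creates a
  \<^const>\<open>reserve\<close> in every round; hence it is a hypothesis only when a single round is left.
\<close>

lemma win2_even_fresh:
  assumes "card (fresh r) = 2 * k" "0 < k" "k = 1 \<Longrightarrow> reserve r x"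
    and "thin r" "x \<in> A" "y \<in> A"
  shows "win2 B r x y"
  using assms
proof (induction k arbitrary: r x y)
  case (Suc k)
  show ?case
  proof (rule enter2)
    fix c assume c: "c \<in> B" "y \<in> r c"
    \<comment> \<open>The fresh count is even and positive, so \<open>c\<close> alone cannot exhaust
      it.\<close>
    have "fresh r - {c} \<noteq> {}"
    proof
      assume "fresh r - {c} = {}"
      then have "card (fresh r) \<le> card {c}" by (intro card_mono) auto
      then show False using Suc.prems(1) by simp
    qed
    then obtain b where b: "b \<in> B" "r b = A" "b \<noteq> c"
      by (auto simp: fresh_def)
    show "win1 B (r(c := r c - {y})) x c"
    proof (cases "r c = A")
      case False
      then have "r c = {y}" using c \<open>thin r\<close> by (auto simp: thin_def)
      then show ?thesis using b c(1) \<open>x \<in> A\<close> by (intro win1_dead_end) auto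
    next
      case True
      have bc: "b \<in> fresh r" "c \<in> fresh r" using b True c by (auto simp: fresh_def)
      have "\<exists>x'\<in>A - {x}. win2 B (r(c := A - {y, y'}, b := A - {x, x'})) x' y'" if y': "y' \<in> A - {y}" for y'
      proof -
        obtain i where i: "A - {y, y'} = {i}" "i \<in> A"
          using leftover[OF \<open>y \<in> A\<close> y'] by metis
        let ?r = "\<lambda>x'. r(c := A - {y, y'}, b := A - {x, x'})"
        have r: "fresh (?r x') = fresh r - {b, c} \<and> thin (?r x')" if x': "x' \<in> A - {x}" for x'
        proof -
          obtain j where j: "A - {x, x'} = {j}" using leftover[OF \<open>x \<in> A\<close> x'] by metis
          show ?thesis unfolding i(1) j
            using fresh_upd[of "{i}" "{j}" r c b] thin_upd[OF Suc.prems(4), of "{i}" i "{j}" j c b]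
            by (auto simp: insert_commute)
        qed
        show ?thesis
        proof (cases "k = 0")
          case True
          have "reserve r x" using Suc.prems True by simp
          then obtain x' where x': "x' \<in> A - {x}"
            "\<forall>r'. (\<forall>b. r b \<noteq> A \<longrightarrow> r' b = r b) \<longrightarrow>
              (\<forall>e. r' e = {y'} \<longrightarrow> (\<exists>b\<in>B. b \<noteq> e \<and> x' \<in> r' b))"
            using reserve_exit[of r x y'] by blast
          \<comment> \<open>This round consumes the last two fresh vertices, so
            \<open>win2_final\<close> applies, with the exit supplied by the reserve.\<close>
          have "card {b, c} = card (fresh r)" using Suc.prems(1) True b by simp
          then have "{b, c} = fresh r"
            using bc by (intro card_subset_eq) auto
          then have "thin (?r x')" "fresh (?r x') = {}" using r[OF x'(1)] by auto
          moreover have "?r x' e = r e" if "r e \<noteq> A" for e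
            using that \<open>r c = A\<close> b by auto
          ultimately have "win2 B (?r x') x' y'"
            using x'(2)[THEN spec[of _ "?r x'"]] y' by (intro win2_final) simp_all
          then show ?thesis using x'(1) by blast
        next
          case False
          \<comment> \<open>The edges left at \<open>c\<close> and \<open>b\<close> end at
            \<open>i\<close> and \<open>j\<close>, both different from \<open>x'\<close>: these two
            vertices are the new reserve.\<close>
          obtain x' where x': "x' \<in> A" "x' \<noteq> x" "x' \<noteq> i"
            using other[OF \<open>x \<in> A\<close> i(2)] .
          obtain j where j: "A - {x, x'} = {j}" "j \<in> A" "j \<noteq> x'"
            using leftover[OF \<open>x \<in> A\<close>, of x'] x' by blast
          have "card (fresh (?r x')) = 2 * k"
            using Suc.prems(1) r[of x'] x' bc b by (simp add: card_Diff_subset)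
          moreover have "reserve (?r x') x'"
            using i j x' b c by (intro reserveI[of c b _ i j]) simp_all
          ultimately have "win2 B (?r x') x' y'"
            using False r[of x'] x'(1,2) y' by (intro Suc.IH[of "?r x'" x' y']) (simp_all del: fun_upd_apply)
          then show ?thesis using x' by blast
        qed
      qed
      then show ?thesis using True b c \<open>x \<in> A\<close> by (intro win1_round) auto
    qed
  qed (use Suc.prems A_notin_B in blast)
qed simp

text \<open>Player 1 waits inside a fresh vertex \<open>b\<close> and so has an exit in hand. If
  Player 2's next entry is not into another fresh vertex, that exit leaves Player 2 trapped;
  otherwise the fresh count drops by two and stays odd.\<close>

lemma win1_odd_fresh:
  assumes "odd (card (fresh r))" "thin r" "x \<in> A" "y \<in> A"
  shows "win1 B r x y"
  using assms
proof (induction "card (fresh r)" arbitrary: r x y rule: less_induct)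
  case less
  have "fresh r \<noteq> {}" using less.prems(1) by force
  then obtain b where b: "b \<in> B" "r b = A" by (auto simp: fresh_def)
  \<comment> \<open>Avoiding \<open>y\<close> keeps this exit available when Player 2 follows into
    \<open>b\<close>, and it is then the last edge there.\<close>
  obtain x' where x': "x' \<in> A" "x' \<noteq> x" "x' \<noteq> y"
    using other[OF \<open>x \<in> A\<close> \<open>y \<in> A\<close>] .
  obtain j where j: "A - {x, x'} = {j}"
    using leftover[OF \<open>x \<in> A\<close>, of x'] x' by blast
  let ?r = "r(b := r b - {x})"
  show ?case
  proof (rule enter1[of b])
    show "win2 B ?r b y"
    proof (rule enter2)
      fix c assume c: "c \<in> B" "y \<in> ?r c"
      let ?r' = "?r(c := ?r c - {y})"
      let ?r'' = "?r'(b := ?r' b - {x'})"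
      show "win1 B ?r' b c"
      proof (rule exit1[of b _ x'])
        show "win2 B ?r'' x' c"
        proof (rule exit2)
          fix y' assume y': "y' \<in> ?r'' c"
          have cb: "c \<noteq> b"
          proof
            assume "c = b"
            with y' c b have "y' \<in> A - {x, x'} - {y}" "y \<in> A - {x, x'}"
              using x' \<open>y \<in> A\<close> by simp_all
            then show False using j by auto
          qed
          \<comment> \<open>Otherwise the entry from \<open>y\<close> has exhausted \<open>c\<close>
            and there is no exit \<open>y'\<close>.\<close>
          then have rc: "r c = A"
            using y' c \<open>thin r\<close> by (auto simp: thin_def)
          then have y'': "y' \<in> A - {y}" using y' cb by auto
          then obtain i where i: "A - {y, y'} = {i}"
            using leftover[OF \<open>y \<in> A\<close>] by metis
          have eq: "?r''(c := ?r'' c - {y'}) = r(c := A - {y, y'}, b := A - {x, x'})"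
            using cb rc b by (auto simp: fun_eq_iff)
          have f: "fresh (r(c := A - {y, y'}, b := A - {x, x'})) = fresh r - {b, c}"
            unfolding i j using fresh_upd[of "{i}" "{j}" r c b] by (auto simp: insert_commute)
          have bc: "{b, c} \<subseteq> fresh r" using b c rc by (auto simp: fresh_def)
          have card: "card (fresh r) = card (fresh r - {b, c}) + 2"
            using bc cb card_mono[OF finite_fresh bc] by (simp add: card_Diff_subset)
          then have "card (fresh r - {b, c}) < card (fresh r) \<and> odd (card (fresh r - {b, c}))"
            using less.prems(1) by simp
          moreover have "thin (r(c := A - {y, y'}, b := A - {x, x'}))"
            unfolding i j using \<open>thin r\<close> by (rule thin_upd) simp_all
          ultimately show "win1 B (?r''(c := ?r'' c - {y'})) x' y'"
            unfolding eq using x'(1) y'' f by (intro less.hyps) simp_all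
        qed fact
      qed (use b c x' in simp_all)
    qed (use \<open>y \<in> A\<close> A_notin_B in blast)
  qed (use b \<open>x \<in> A\<close> in simp_all)
qed

section \<open>Replies of Player 2 to the opening\<close>

lemma win2_all_dead:
  assumes "y \<in> A" "\<And>c. c \<in> B \<Longrightarrow> y \<in> r c \<Longrightarrow> r c = {y} \<and> (\<exists>b\<in>B. b \<noteq> c \<and> x \<in> r b)"
  shows "win2 B r x y"
proof (rule enter2)
  fix c assume "c \<in> B" "y \<in> r c"
  with assms(2) show "win1 B (r(c := r c - {y})) x c"
    using win1_dead_end by metis
qed (use assms(1) A_notin_B in blast)

lemma win1_shared_vertex:
  assumes "b \<in> B" "r b = {i}"
  shows "win1 B r b b"
proof (rule exit1[where a = i])
  show "win2 B (r(b := r b - {i})) i b"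
    by (rule exit2) (use assms in simp_all)
qed (use assms in simp_all)

text \<open>Once both players have completed their first visits, \<open>card B - 2\<close> fresh
  vertices remain, an odd number with Player 1 to move.\<close>

lemma win1_start_enter:
  assumes "b \<in> B" "c \<in> B" "c \<noteq> b" "a \<in> A" "u \<in> A" "r b = A - {a}" "r c = A - {u}"
    and "\<forall>e\<in>B - {b, c}. r e = A" "odd (card B)"
  shows "win1 B r b c"
proof -
  obtain x where x: "x \<in> A" "x \<noteq> a" using other[OF assms(4,4)] by blast
  obtain i where i: "A - {a, x} = {i}" using leftover[OF assms(4), of x] x by blast
  show ?thesis
  proof (rule exit1[where a = x])
    show "win2 B (r(b := r b - {x})) x c"
    proof (rule exit2)
      fix y assume "y \<in> (r(b := r b - {x})) c"
      then have y: "y \<in> A - {u}" using assms(3,7) by simp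
      then obtain j where j: "A - {u, y} = {j}" using leftover[OF assms(5)] by blast
      let ?r = "r(b := {i}, c := {j})"
      have eq: "(r(b := r b - {x}))(c := (r(b := r b - {x})) c - {y}) = ?r"
        using i j assms(3,6,7) by (auto simp: fun_eq_iff)
      have "fresh ?r = B - {b, c}"
        using assms(8) by (auto simp: fresh_def)
      then have "card (fresh ?r) + 2 = card B"
        using assms(1-3) fin_B card_mono[of B "{b, c}"] by (simp add: card_Diff_subset)
      then have "odd (card (fresh ?r))"
        using assms(9) by (metis even_add even_numeral)
      moreover have "thin ?r" using assms(8) by (auto simp: thin_def)
      ultimately show "win1 B ((r(b := r b - {x}))(c := (r(b := r b - {x})) c - {y})) x y"
        unfolding eq using x y by (intro win1_odd_fresh) simp_all
    qed fact
  qed (use assms(1,6) x in simp_all)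
qed

text \<open>Both opening edges meet \<open>b\<close>, so leaving along its last edge exhausts it. An
  even number of at least four fresh vertices remains, for which \<open>win2_even_fresh\<close> asks
  no reserve.\<close>

lemma win1_start_leave_shared:
  assumes "b \<in> B" "a \<in> A" "v \<in> A - {a}" "r b = A - {a, v}"
    and "\<forall>e\<in>B - {b}. r e = A" "odd (card B)" "5 \<le> card B"
  shows "win1 B r b v"
proof -
  obtain i where i: "A - {a, v} = {i}" "i \<in> A" using leftover[OF assms(2,3)] by metis
  let ?r = "r(b := r b - {i})"
  have "fresh ?r = B - {b}"
    using assms(1,4,5) i A_not_subset_singleton[of i] by (auto simp: fresh_def)
  then have "card (fresh ?r) + 1 = card B"
    using assms(1,7) fin_B by simp
  moreover obtain k where "card B = 2 * k + 1" using assms(6) by (rule oddE)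
  ultimately have "card (fresh ?r) = 2 * k" "2 \<le> k" using assms(7) by simp_all
  moreover have "thin ?r" using assms(4,5) i by (auto simp: thin_def)
  ultimately have "win2 B ?r i v"
    using i assms(3) by (intro win2_even_fresh[of _ k]) simp_all
  then show ?thesis
    using assms(1,4) i by (intro exit1[where a = i]) simp_all
qed

text \<open>
  Player 2 started with a traversal from \<open>d\<close> to \<open>y\<close> and cannot return to \<open>d\<close> at once, so
  Player 1 can visit \<open>d\<close> first.
\<close>

lemma win2_visit_start:
  assumes "x \<in> A" "y \<in> A" "x \<noteq> y" "d \<in> B" "r d = A - {y}"
    and "\<forall>b\<in>B - {d}. r b = A \<or> (\<exists>i. r b \<subseteq> {i})" "card (fresh r) = 2 * k + 1" "2 \<le> k"
  shows "win2 B r x y"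
proof (rule enter2)
  fix c assume c: "c \<in> B" "y \<in> r c"
  then have cd: "c \<noteq> d" using assms(5) by auto
  obtain z where z: "A = {x, y, z}" "z \<noteq> x" "z \<noteq> y" by (rule third[OF assms(1-3)])
  then have rd: "r d = {x, z}" using assms(3,5) by auto
  show "win1 B (r(c := r c - {y})) x c"
  proof (cases "r c = A")
    case False
    then have "r c = {y}" using c cd assms(6) by auto
    then show ?thesis using c cd rd assms(4) by (intro win1_dead_end[of c B r y d]) simp_all
  next
    case True
    \<comment> \<open>Passing through \<open>d\<close> uses up its two edges without spending a
      fresh vertex, while Player 2 spends \<open>c\<close>: the odd count becomes
      \<open>2 * k\<close>.\<close>
    show ?thesis
    proof (rule win1_round[of c B d])
      fix y' assume "y' \<in> r c - {y}"
      then have y': "y' \<in> A - {y}" using True by simp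
      obtain i where i: "A - {y, y'} = {i}" using leftover[OF assms(2) y'] by metis
      let ?r = "r(c := {i}, d := {})"
      have eq: "r(c := r c - {y, y'}, d := r d - {x, z}) = ?r"
        using True i rd by simp
      have "fresh ?r = fresh r - {c}"
        using assms(1,5) assms(2) by (auto simp: fresh_def)
      moreover have "c \<in> fresh r" using c True by (simp add: fresh_def)
      ultimately have "card (fresh ?r) = 2 * k" using assms(7) by simp
      moreover have "thin ?r" using assms(6) by (auto simp: thin_def)
      moreover have "z \<in> A" "y' \<in> A" using y' z(1) by auto
      ultimately have "win2 B ?r z y'"
        using assms(8) by (intro win2_even_fresh[of _ k]) simp_all
      then show "\<exists>x'\<in>r d - {x}. win2 B (r(c := r c - {y, y'}, d := r d - {x, x'})) x' y'"
        using rd z eq by (intro bexI[of _ z]) simp_all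
    qed (use c cd rd assms(4) in simp_all)
  qed
qed (use assms(2) A_notin_B in blast)

text \<open>
  For \<open>card B = 5\<close> too few visits remain to build a \<^const>\<open>reserve\<close> after the visit of \<open>d\<close>, so the
  openings of Player 2 from \<open>d\<close> are played out: \<open>same\<close> refers to Player 2 moving to the vertex
  where Player 1 started, \<open>other\<close> to the remaining ones.
\<close>

lemma win1_five_same_last:
  assumes A: "A = {a, s, t}" "a \<noteq> s" "a \<noteq> t" "s \<noteq> t"
    and B: "B = {b, d, c, p, e}" "distinct [b, d, c, p, e]"
    and r: "r b = {t}" "r d = {}" "r p = A" "r e = A"
    and y: "y = t \<and> r c = {s} \<or> y = s \<and> r c = {t}"
  shows "win1 B (r(p := r p - {y})) t p"
proof (rule win1_round[of p B e])
  fix y' assume "y' \<in> r p - {y}"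
  then have y': "y' = a \<or> y = t \<and> y' = s \<or> y = s \<and> y' = t" using y A r by auto
  \<comment> \<open>In the first case \<open>c\<close> and \<open>p\<close> keep edges at
    \<open>s\<close>. With exit \<open>a\<close>, either \<open>p\<close> keeps an edge at
    \<open>a\<close>, or Player 2 has no move at all.\<close>
  define x' where "x' = (if y = t \<and> y' = a then s else a)"
  have "win2 B (r(p := r p - {y, y'}, e := r e - {t, x'})) x' y'"
  proof (rule win2_all_dead)
    show "y' \<in> A" using y' A by auto
    fix c' assume c': "c' \<in> B" "y' \<in> (r(p := r p - {y, y'}, e := r e - {t, x'})) c'"
    show "(r(p := r p - {y, y'}, e := r e - {t, x'})) c' = {y'} \<and>
        (\<exists>b\<in>B. b \<noteq> c' \<and> x' \<in> (r(p := r p - {y, y'}, e := r e - {t, x'})) b)"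
      using c' y y' A(2-4) B(2) r unfolding A(1) B(1) x'_def by (auto split: if_splits)
  qed
  moreover have "x' \<in> r e - {t}" using A r by (auto simp: x'_def)
  ultimately show "\<exists>x'\<in>r e - {t}. win2 B (r(p := r p - {y, y'}, e := r e - {t, x'})) x' y'"
    by blast
qed (use A B r in auto)

lemma win2_five_same_last:
  assumes A: "A = {a, s, t}" "a \<noteq> s" "a \<noteq> t" "s \<noteq> t"
    and B: "B = {b, d, c, p, e}" "distinct [b, d, c, p, e]"
    and r: "r b = {t}" "r d = {}" "r p = A" "r e = A"
    and y: "y = t \<and> r c = {s} \<or> y = s \<and> r c = {t}"
  shows "win2 B r t y"
proof (rule enter2)
  fix c' assume c': "c' \<in> B" "y \<in> r c'"
  then consider "c' = b" "y = t" | "c' = p" | "c' = e" using y A(4) B(1) r by auto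
  then show "win1 B (r(c' := r c' - {y})) t c'"
  proof cases
    case 1
    then show ?thesis using A B r by (intro win1_dead_end[of _ _ _ _ p]) auto
  next
    case 2
    then show ?thesis using win1_five_same_last[OF A B r y] by simp
  next
    case 3
    have "B = {b, d, c, e, p}" "distinct [b, d, c, e, p]" using B by auto
    then show ?thesis using win1_five_same_last[OF A _ _ r(1,2,4,3) y] 3 by simp
  qed
qed (use A y A_notin_B in auto)

text \<open>From \<open>a\<close> only the three fresh vertices are open to Player 2. Player 1
  answers through \<open>d\<close> to \<open>t\<close>, which exhausts \<open>d\<close> and leaves
  two fresh vertices for the last round.\<close>

lemma win2_five_same:
  assumes A: "A = {a, s, t}" "a \<noteq> s" "a \<noteq> t" "s \<noteq> t"
    and B: "b \<in> B" "d \<in> B" "b \<noteq> d" "card (B - {b, d}) = 3"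
    and r: "r b = {t}" "r d = {s, t}" "\<And>c. c \<in> B - {b, d} \<Longrightarrow> r c = A"
  shows "win2 B r s a"
proof (rule enter2)
  fix c assume c: "c \<in> B" "a \<in> r c"
  then have cbd: "c \<in> B - {b, d}" using A r by auto
  then have "card (B - {b, d} - {c}) = 2" using B(4) fin_B by simp
  then obtain p e where pe: "B - {b, d} - {c} = {p, e}" "p \<noteq> e" by (auto simp: card_2_iff)
  then have B': "B = {b, d, c, p, e}" "distinct [b, d, c, p, e]" using B cbd by auto
  show "win1 B (r(c := r c - {a})) s c"
  proof (rule win1_round[of c B d])
    fix y assume "y \<in> r c - {a}"
    then have y: "y = s \<or> y = t" using A r(3)[OF cbd] by auto
    have "win2 B (r(c := r c - {a, y}, d := r d - {s, t})) t y"
      by (rule win2_five_same_last[OF A B']) (use y A B' r in auto)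
    then show "\<exists>x'\<in>r d - {s}. win2 B (r(c := r c - {a, y}, d := r d - {s, x'})) x' y"
      using A r by (intro bexI[of _ t]) auto
  qed (use B cbd r in auto)
qed (use A A_notin_B in auto)

text \<open>If Player 2 enters a dead end or \<open>d\<close> from \<open>t\<close>, moving into
  \<open>d\<close> wins at once. Otherwise Player 1's round ends at \<open>t\<close>, where
  \<open>b\<close> and \<open>g\<close> both keep an edge.\<close>

lemma win2_five_other_last:
  assumes A: "A = {a, s, t}" "a \<noteq> s" "a \<noteq> t" "s \<noteq> t"
    and B: "B = {b, d, c, g, h}" "distinct [b, d, c, g, h]"
    and r: "r b = {t}" "r d = {a, t}" "r g = {t}" "r h = A"
    and y: "y = a \<and> r c = {t} \<or> y = t \<and> r c = {a}"
  shows "win2 B r a y"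
proof (rule enter2)
  fix c' assume c': "c' \<in> B" "y \<in> r c'"
  then consider "c' = b \<or> c' = g" "y = t" | "c' = d" "y = t" | "c' = d" "y = a" | "c' = h"
    using y A(2-4) B(1) r by auto
  then show "win1 B (r(c' := r c' - {y})) a c'"
  proof cases
    case 1
    then show ?thesis using B r by (intro win1_dead_end[of _ _ _ _ d]) auto
  next
    case 2
    show ?thesis
    proof (rule enter1[where b = d])
      show "win2 B ((r(c' := r c' - {y}))(d := (r(c' := r c' - {y})) d - {a})) d c'"
        by (rule exit2) (use 2 B r in auto)
    qed (use 2 A B r in auto)
  next
    case 3
    show ?thesis
    proof (rule win1_round[of c' B h])
      fix y' assume "y' \<in> r c' - {y}"
      then have y': "y' = t" using 3 r by auto
      have "win2 B (r(c' := r c' - {y, y'}, h := r h - {a, t})) t y'"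
        by (rule win2_all_dead) (use A B r y y' 3 in auto)
      then show "\<exists>x'\<in>r h - {a}. win2 B (r(c' := r c' - {y, y'}, h := r h - {a, x'})) x' y'"
        using A r by (intro bexI[of _ t]) auto
    qed (use 3 A B r in auto)
  next
    case 4
    show ?thesis
    proof (rule win1_round[of c' B d])
      fix y' assume "y' \<in> r c' - {y}"
      then have y': "y' = s \<or> y = a \<and> y' = t \<or> y = t \<and> y' = a" using 4 r A y by auto
      have "win2 B (r(c' := r c' - {y, y'}, d := r d - {a, t})) t y'"
      proof (rule win2_all_dead)
        show "y' \<in> A" using y' A by auto
        fix e assume e: "e \<in> B" "y' \<in> (r(c' := r c' - {y, y'}, d := r d - {a, t})) e"
        show "(r(c' := r c' - {y, y'}, d := r d - {a, t})) e = {y'} \<and>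
          (\<exists>b\<in>B. b \<noteq> e \<and> t \<in> (r(c' := r c' - {y, y'}, d := r d - {a, t})) b)"
          using e 4 y y' A(2-4) B(2) r unfolding A(1) B(1) by auto
      qed
      then show "\<exists>x'\<in>r d - {a}. win2 B (r(c' := r c' - {y, y'}, d := r d - {a, x'})) x' y'"
        using A r by (intro bexI[of _ t]) auto
    qed (use 4 A B r in auto)
  qed
qed (use A y A_notin_B in auto)

text \<open>Player 1 answers through a fresh vertex to \<open>a\<close>, saving \<open>d\<close>,
  which has edges left at \<open>a\<close> and \<open>t\<close>, for the last exchange.\<close>

lemma win2_five_other:
  assumes A: "A = {a, s, t}" "a \<noteq> s" "a \<noteq> t" "s \<noteq> t"
    and B: "b \<in> B" "d \<in> B" "b \<noteq> d" "card (B - {b, d}) = 3"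
    and r: "r b = {t}" "r d = {a, t}" "\<And>c. c \<in> B - {b, d} \<Longrightarrow> r c = A"
  shows "win2 B r s s"
proof (rule enter2)
  fix c assume c: "c \<in> B" "s \<in> r c"
  then have cbd: "c \<in> B - {b, d}" using A r by auto
  then have "card (B - {b, d} - {c}) = 2" using B(4) fin_B by simp
  then obtain g h where gh: "B - {b, d} - {c} = {g, h}" "g \<noteq> h" by (auto simp: card_2_iff)
  then have B': "B = {b, d, c, g, h}" "distinct [b, d, c, g, h]" using B cbd by auto
  show "win1 B (r(c := r c - {s})) s c"
  proof (rule win1_round[of c B g])
    fix y assume "y \<in> r c - {s}"
    then have y: "y = a \<or> y = t" using A r(3)[OF cbd] by auto
    have "win2 B (r(c := r c - {s, y}, g := r g - {s, a})) a y"
      by (rule win2_five_other_last[OF A B']) (use y A B' r in auto)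
    then show "\<exists>x'\<in>r g - {s}. win2 B (r(c := r c - {s, y}, g := r g - {s, x'})) x' y"
      using A B' r by (intro bexI[of _ a]) auto
  qed (use A B' r in auto)
qed (use A A_notin_B in auto)

text \<open>If \<open>card B\<close> is at least 7, Player 1 leaves to a vertex other than
  \<open>v\<close> and \<open>win2_visit_start\<close> applies; for 5 the case split is whether
  Player 2 moved to Player 1's start \<open>a\<close>.\<close>

lemma win1_start_leave:
  assumes "b \<in> B" "d \<in> B" "d \<noteq> b" "a \<in> A" "v \<in> A" "r b = A - {a}" "r d = A - {v}"
    and rest: "\<forall>e\<in>B - {b, d}. r e = A" and "odd (card B)" "5 \<le> card B"
  shows "win1 B r b v"
proof -
  obtain k where k: "card B = 2 * k + 1" using assms(9) by (rule oddE)
  have card: "card (B - {b, d}) = 2 * (k - 1) + 1"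
    using assms(1-3,10) k fin_B by (simp add: card_Diff_subset)
  have "\<exists>x\<in>A - {a}. win2 B (r(b := A - {a, x})) x v"
  proof (cases "k = 2")
    case False
    obtain x where x: "x \<in> A" "x \<noteq> a" "x \<noteq> v" using other[OF assms(4,5)] by blast
    obtain i where i: "A - {a, x} = {i}" using leftover[OF assms(4), of x] x by blast
    let ?r = "r(b := {i})"
    have "fresh ?r = B - {b, d}"
      using rest assms(3,5,7) by (auto simp: fresh_def)
    then have "card (fresh ?r) = 2 * (k - 1) + 1" using card by simp
    moreover have "\<forall>e\<in>B - {d}. ?r e = A \<or> (\<exists>i. ?r e \<subseteq> {i})" using rest by auto
    ultimately have "win2 B ?r x v"
      using False k assms(2,3,5,7,10) x by (intro win2_visit_start[of _ _ d _ "k - 1"]) simp_all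
    then show ?thesis using x i by (intro bexI[of _ x]) simp_all
  next
    case True
    then have card3: "card (B - {b, d}) = 3" using card by simp
    show ?thesis
    proof (cases "v = a")
      case True
      obtain s where s: "s \<in> A" "s \<noteq> a" using other[OF assms(4,4)] by blast
      obtain t where t: "A = {a, s, t}" "t \<noteq> a" "t \<noteq> s"
        using third[of a s] assms(4) s by blast
      have "win2 B (r(b := A - {a, s})) s a"
        using t s assms True card3 by (intro win2_five_same[of a s t b d]) auto
      then show ?thesis using s True by auto
    next
      case False
      obtain t where t: "A = {a, v, t}" "t \<noteq> a" "t \<noteq> v"
        using third[of a v] assms(4,5) False by blast
      have "win2 B (r(b := A - {a, v})) v v"
        using t assms False card3 by (intro win2_five_other[of a v t b d]) auto
      then show ?thesis using assms(5) False by auto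
    qed
  qed
  then obtain x where x: "x \<in> A - {a}" "win2 B (r(b := A - {a, x})) x v" by blast
  have "A - {a} - {x} = A - {a, x}" by blast
  then show ?thesis using x assms(1,6) by (intro exit1[where a = x]) simp_all
qed

end

section \<open>Complete bipartite graphs\<close>

text \<open>The involution changes the end in \<open>A\<close> of every edge and keeps the end in
  \<open>B\<close>, so no edge is mapped to itself.\<close>

lemma even_side_P2_win:
  assumes arcs: "arcs_ends G = A \<times> B \<union> B \<times> A" and disj: "A \<inter> B = {}"
    and fin: "finite A" "finite B" and "even (card A)"
  shows "P2_win G"
proof -
  obtain \<phi> where \<phi>: "\<And>u. u \<in> A \<Longrightarrow> \<phi> u \<in> A" "\<And>u. u \<in> A \<Longrightarrow> \<phi> u \<noteq> u"
    "\<And>u. \<phi> (\<phi> u) = u" "\<And>u. u \<notin> A \<Longrightarrow> \<phi> u = u"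
    using even_card_involution[OF fin(1) assms(5)] by metis
  have B: "\<phi> v = v" if "v \<in> B" for v
    using \<phi>(4) disj that by blast
  show ?thesis
  proof (rule mirror_P2_win[of _ \<phi>])
    show "finite (arcs_ends G)" using arcs fin by simp
    show "(\<phi> u, \<phi> v) \<in> arcs_ends G" if "(u, v) \<in> arcs_ends G" for u v
      using that \<phi>(1) B unfolding arcs by auto
    show "{\<phi> u, \<phi> v} \<noteq> {u, v}" if "(u, v) \<in> arcs_ends G" for u v
      using that \<phi>(1,2) B disj unfolding arcs by (auto simp: doubleton_eq_iff)
  qed (rule \<phi>(3))
qed

lemma three_odd_P1_win:
  assumes arcs: "arcs_ends G = A \<times> B \<union> B \<times> A" and disj: "A \<inter> B = {}"
    and "finite B" "card A = 3" "5 \<le> card B" "odd (card B)"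
  shows "P1_win G"
proof -
  interpret K3n A B using assms by unfold_locales
  obtain a where a: "a \<in> A" using assms(4) by (metis card.empty ex_in_conv zero_neq_numeral)
  obtain b where b: "b \<in> B" using assms(5) by fastforce
  have "P1_forces G [(a, b)]"
  proof (rule P2_turn)
    fix m assume leg: "legal_move G [(a, b)] m"
    obtain u v where m: "m = (u, v)" by force
    let ?h = "[(a, b), (u, v)]"
    have uv: "(u, v) \<in> A \<times> B \<union> B \<times> A" "{u, v} \<noteq> {a, b}"
      using leg arcs m by (auto simp: legal_move_def used_edges_def)
    have un: "unused A ?h e = {c \<in> A. {c, e} \<noteq> {a, b} \<and> {c, e} \<noteq> {u, v}}" for e
      by (auto simp: unused_def used_edges_def)
    have "win1 B (unused A ?h) b v"
    \<comment> \<open>Player 2's first move enters or leaves \<open>B\<close>, at \<open>b\<close>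
      or at another vertex: four cases, one opening lemma each.\<close>
    proof (cases "u \<in> A")
      case True
      then have v: "v \<in> B" using uv(1) disj by auto
      have un': "unused A ?h e = A - (if e = b then {a} else {}) - (if e = v then {u} else {})"
        if "e \<in> B" for e
        using that a b True v disj by (auto simp: un doubleton_eq_iff)
      show ?thesis
      proof (cases "v = b")
        case vb: True
        then have "u \<in> A - {a}" using uv(2) True by auto
        then obtain i where "A - {a, u} = {i}" using leftover[OF a] by metis
        moreover have "A - {a} - {u} = A - {a, u}" by blast
        ultimately show ?thesis
          using vb b un' by (simp add: win1_shared_vertex[where i = i])
      next
        case False
        then show ?thesis
          using un' a b v True assms(6) by (intro win1_start_enter[of b v a u]) simp_all
      qed
    next
      case False
      then have uB: "u \<in> B" "v \<in> A" using uv(1) by auto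
      have un': "unused A ?h e = A - (if e = b then {a} else {}) - (if e = u then {v} else {})"
        if "e \<in> B" for e
        using that a b uB disj by (auto simp: un doubleton_eq_iff)
      show ?thesis
      proof (cases "u = b")
        case True
        then have "v \<noteq> a" using uv(2) by auto
        moreover have "A - {a} - {v} = A - {a, v}" by blast
        ultimately show ?thesis
          using un' a b uB True assms(5,6) by (intro win1_start_leave_shared[of b a v]) simp_all
      next
        case False
        then show ?thesis
          using un' a b uB assms(5,6) by (intro win1_start_leave[of b u a v]) simp_all
      qed
    qed
    from win_P1_forces(1)[OF arcs disj this, rule_format, of ?h]
    show "P1_forces G ([(a, b)] @ [m])" using m by simp
  qed simp
  moreover have "legal_move G [] (a, b)"
    using a b arcs by (simp add: legal_move_def)
  ultimately have "P1_forces G []" using P1_turn[of "[]" G "(a, b)"] by simp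
  then show ?thesis by (rule P1_forces_P1_win)
qed

theorem theorem3p2:
  fixes p q :: nat and G :: "('a, 'b) pre_digraph"
  assumes "0 < p" and "0 < q"
    and "complete_bipartite_digraph p q G"
  shows "(even p \<or> even q \<longrightarrow> P2_win G) \<and>
         (p = 3 \<and> 5 \<le> q \<and> odd q \<longrightarrow> P1_win G)"
proof -
  obtain U V where UV: "U \<inter> V = {}" "card U = p" "card V = q" "arcs_ends G = U \<times> V \<union> V \<times> U"
    using assms(3) by (auto simp: complete_bipartite_digraph_def)
  have fin: "finite U" "finite V"
    \<comment> \<open>Infinite sets have \<open>card\<close> 0, so positivity of \<open>p\<close>
      and \<open>q\<close> yields finiteness.\<close>
    using UV(2,3) assms(1,2) card_gt_0_iff by blast+
  have VU: "V \<inter> U = {}" "arcs_ends G = V \<times> U \<union> U \<times> V" using UV(1,4) by auto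
  show ?thesis
    using even_side_P2_win[OF UV(4,1) fin] even_side_P2_win[OF VU(2,1) fin(2,1)]
      three_odd_P1_win[OF UV(4,1) fin(2)] UV(2,3) by auto
qed

end
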